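(* For every integer $n\ge 3$, the sequence $\{\beta_{n,k}\}_{k=0}^{n-1}$ is unimodal.
   Context: The polynomials $p_n(w)$, $n\ge 1$, are defined by $p_1(w)=1$ and the recurrence $p_{n+1}(w) = -(nw+3n-1)p_n(w) + (1+w)p_n'(w)$ for $n\ge 1$. Each $p_n$ has degree at most $n-1$, and the coefficients $\beta_{n,k}$ ($0\le k\le n-1$) are defined by $p_n(w) = (-1)^{n-1}\sum_{k=0}^{n-1}\beta_{n,k}w^k$. A finite sequence $c_0,c_1,\ldots,c_N$ of real numbers is called unimodal if for some $0\le j\le N$ one has $c_0\le c_1\le\cdots\le c_j\ge c_{j+1}\ge\cdots\ge c_N$. *)

theory Defs
  imports Complex_Main "HOL-Computational_Algebra.Polynomial"
begin

(* The family starts at index 1; the value at index 0 is a dummy.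
   The third equation is the recurrence
     p_{n+1}(w) = -(n w + 3 n - 1) p_n(w) + (1 + w) p_n'(w)   for n = Suc m >= 1. *)
fun p_poly :: "nat \<Rightarrow> real poly" where
  "p_poly 0 = 0"
| "p_poly (Suc 0) = 1"
| "p_poly (Suc (Suc m)) =
     - ([:3 * real (Suc m) - 1, real (Suc m):] * p_poly (Suc m))
     + [:1, 1:] * pderiv (p_poly (Suc m))"

(* Solves p_n(w) = (-1)^(n-1) * (\<Sum>k<n. beta n k * w^k) for the coefficients;
   see p_poly_expansion below. *)
definition beta :: "nat \<Rightarrow> nat \<Rightarrow> real" where
  "beta n k = (-1) ^ (n - 1) * coeff (p_poly n) k"

(* Unimodality of the finite sequence c 0, ..., c N; values of c beyond N are irrelevant. *)
definition unimodal :: "nat \<Rightarrow> (nat \<Rightarrow> real) \<Rightarrow> bool" where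
  "unimodal N c \<longleftrightarrow>
     (\<exists>j\<le>N. (\<forall>i<j. c i \<le> c (Suc i)) \<and> (\<forall>i. j \<le> i \<and> i < N \<longrightarrow> c i \<ge> c (Suc i)))"

lemma p_poly_rec:
  assumes "n \<ge> 1"
  shows "poly (p_poly (n + 1)) w =
    - (real n * w + 3 * real n - 1) * poly (p_poly n) w + (1 + w) * poly (pderiv (p_poly n)) w"
proof -
  obtain m where "n = Suc m" using assms by (cases n) auto
  then show ?thesis by (simp add: algebra_simps)
qed

lemma degree_p_poly: "degree (p_poly n) \<le> n - 1"
proof (induction n rule: p_poly.induct)
  case (3 m)
  have "degree ([:3 * real (Suc m) - 1, real (Suc m):] * p_poly (Suc m)) \<le> Suc m"
    using degree_mult_le[of "[:3 * real (Suc m) - 1, real (Suc m):]" "p_poly (Suc m)"] 3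
    by simp
  moreover have "degree ([:1, 1:] * pderiv (p_poly (Suc m))) \<le> Suc m"
    using degree_mult_le[of "[:1, 1:]" "pderiv (p_poly (Suc m))"] 3
    by (simp add: degree_pderiv)
  ultimately show ?case
    unfolding p_poly.simps diff_Suc_1 by (intro degree_add_le) (simp_all only: degree_minus)
qed simp_all

lemma p_poly_expansion:
  assumes "n \<ge> 1"
  shows "poly (p_poly n) w = (-1) ^ (n - 1) * (\<Sum>k=0..n-1. beta n k * w ^ k)"
proof -
  have "poly (p_poly n) w = (\<Sum>k\<le>n-1. coeff (p_poly n) k * w ^ k)"
    unfolding poly_altdef using degree_p_poly[of n]
    by (intro sum.mono_neutral_left) (auto simp: coeff_eq_0)
  also have "\<dots> = (\<Sum>k=0..n-1. (-1) ^ (n - 1) * (beta n k * w ^ k))"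
    by (intro sum.cong) (auto simp: beta_def simp flip: mult.assoc power_add mult_2)
  finally show ?thesis by (simp add: sum_distrib_left)
qed

end

theory Submission
  imports Defs
begin

text \<open>
  Write \<open>q\<^sub>n = (-1)\<^sup>n\<^sup>-\<^sup>1 p\<^sub>n\<close>, so that the numbers \<open>beta n k\<close> are the coefficients of \<open>q\<^sub>n\<close>. In the
  variable \<open>w\<close> their recurrence contains negative terms, because of the derivative. The
  substitution \<open>w = x - 1\<close> repairs this: \<open>r\<^sub>n(x) = q\<^sub>n(x - 1)\<close> satisfies
  \<open>r\<^sub>n\<^sub>+\<^sub>1 = (n x + 2 n - 1) r\<^sub>n - x r\<^sub>n'\<close>, that is, the coefficients \<open>a\<^sub>n\<^sub>,\<^sub>j\<close> of \<open>r\<^sub>n\<close> satisfy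
  \<open>a\<^sub>n\<^sub>+\<^sub>1\<^sub>,\<^sub>j = (2 n - 1 - j) a\<^sub>n\<^sub>,\<^sub>j + n a\<^sub>n\<^sub>,\<^sub>j\<^sub>-\<^sub>1\<close>, where \<open>2 n - 1 - j\<close> is nonnegative for \<open>j \<le> n\<close>.

  The proof establishes log-concavity, which is stronger than unimodality. A triangular recurrence
  whose weights are nonnegative and affine in \<open>j\<close> preserves log-concavity
  (\<open>log_concave_affine_step\<close>), so every \<open>r\<^sub>n\<close> is log-concave. It remains to return to
  \<open>w\<close>, and the substitution \<open>x = w + 1\<close> preserves log-concavity as well
  (\<open>log_concave_shift\<close>). For the latter, split \<open>f = a + x g\<close>: then
  \<open>f(1 + w) = a + (1 + w) g(1 + w)\<close>, and by induction \<open>(1 + w) g(1 + w)\<close> is log-concave. The extra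
  constant \<open>a\<close> threatens only the inequalities that involve the constant coefficient, and the decisive
  one, \<open>f(1) f''(1) / 2 \<le> f'(1)\<^sup>2\<close>, follows from the fact that \<open>a g'\<close> is bounded by \<open>g\<^sup>2\<close>
  coefficient by coefficient (\<open>log_concave_pderiv_le_square\<close>).
\<close>

section \<open>Log-concave polynomials\<close>

text \<open>
  For positive coefficients the second clause says that the ratios of consecutive coefficients
  decrease, which is equivalent to \<open>c\<^sub>i c\<^sub>i\<^sub>+\<^sub>2 \<le> c\<^sub>i\<^sub>+\<^sub>1\<^sup>2\<close>. For coefficients that may vanish, the
  two-index form also excludes internal zeros such as those of \<open>1 + x\<^sup>3\<close>.
\<close>

definition log_concave :: "real poly \<Rightarrow> bool" where
  "log_concave p \<longleftrightarrow> (\<forall>i. 0 \<le> coeff p i) \<and>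
     (\<forall>i j. i \<le> j \<longrightarrow> coeff p i * coeff p (Suc j) \<le> coeff p (Suc i) * coeff p j)"

lemma log_concave_nonneg: "log_concave p \<Longrightarrow> 0 \<le> coeff p i"
  by (simp add: log_concave_def)

lemma log_concaveD:
  "log_concave p \<Longrightarrow> i \<le> j \<Longrightarrow> coeff p i * coeff p (Suc j) \<le> coeff p (Suc i) * coeff p j"
  by (simp add: log_concave_def)

lemma log_concave_pCons_tail:
  assumes "log_concave (pCons a g)"
  shows "log_concave g"
  unfolding log_concave_def
proof (intro conjI allI impI)
  show "0 \<le> coeff g i" for i
    using log_concave_nonneg[OF assms, of "Suc i"] by simp
  show "coeff g i * coeff g (Suc j) \<le> coeff g (Suc i) * coeff g j" if "i \<le> j" for i j
    using log_concaveD[OF assms, of "Suc i" "Suc j"] that by simp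
qed

lemma log_concave_spread:
  assumes "log_concave p" "k \<le> l" "m \<le> k"
  shows "coeff p (k - m) * coeff p (l + m) \<le> coeff p k * coeff p l"
  using assms(3)
proof (induction m)
  case (Suc m)
  have "coeff p (k - Suc m) * coeff p (Suc (l + m))
      \<le> coeff p (Suc (k - Suc m)) * coeff p (l + m)"
    using assms(2) Suc.prems by (intro log_concaveD[OF assms(1)]) simp
  with Suc show ?case by (simp add: Suc_diff_Suc)
qed simp

lemma log_concave_endpoints:
  assumes "log_concave p"
  shows "coeff p 0 * coeff p (k + l) \<le> coeff p k * coeff p l"
proof (cases "k \<le> l")
  case True
  then show ?thesis using log_concave_spread[OF assms, of k l k] by (simp add: add.commute)
next
  case False
  then show ?thesis
    using log_concave_spread[OF assms, of l k l] by (simp add: mult.commute)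
qed

text \<open>
  The sequence of coefficients increases up to the first strict descent; once it has descended,
  the ratios of consecutive coefficients stay below \<open>1\<close>.
\<close>

lemma log_concave_imp_unimodal:
  assumes "log_concave p"
  shows "unimodal N (coeff p)"
proof -
  define descent where "descent j \<longleftrightarrow> j = N \<or> coeff p (Suc j) < coeff p j" for j
  define j where "j = (LEAST j. descent j)"
  have "descent N" by (simp add: descent_def)
  then have "descent j" and "j \<le> N"
    unfolding j_def by (auto intro: LeastI Least_le)
  have "coeff p i \<le> coeff p (Suc i)" if "i < j" for i
    using not_less_Least[OF that[unfolded j_def]] by (simp add: descent_def)
  moreover have "coeff p (Suc i) \<le> coeff p i" if "j \<le> i" "i < N" for i
  proof -
    have drop: "coeff p (Suc j) < coeff p j"
      using \<open>descent j\<close> that by (simp add: descent_def)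
    then have pos: "0 < coeff p j"
      using log_concave_nonneg[OF assms, of "Suc j"] by linarith
    have "coeff p j * coeff p (Suc i) \<le> coeff p (Suc j) * coeff p i"
      using log_concaveD[OF assms that(1)] .
    also have "\<dots> \<le> coeff p j * coeff p i"
      using drop log_concave_nonneg[OF assms] by (intro mult_right_mono) auto
    finally show ?thesis using pos by simp
  qed
  ultimately show ?thesis
    using \<open>j \<le> N\<close> unfolding unimodal_def by blast
qed

section \<open>Triangular recurrences with affine weights\<close>

lemma coeff_affine_step:
  fixes p :: "real poly"
  shows "coeff ([:u, e:] * p - smult v (pCons 0 (pderiv p))) k
    = (u - v * real k) * coeff p k + e * coeff (pCons 0 p) k"
  by (cases k) (simp_all add: coeff_pderiv algebra_simps)

text \<open>
  With \<open>d\<^sub>k = u - v k\<close>, the new coefficients are \<open>d\<^sub>k a\<^sub>k + e a\<^sub>k\<^sub>-\<^sub>1\<close>. Expanding both sides of the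
  inequality for \<open>i < j\<close> and sorting by powers of \<open>e\<close>, the outer terms compare because \<open>a\<close> and \<open>d\<close> are
  both log-concave, and the middle terms because \<open>d\<close> is affine and
  \<open>a\<^sub>i\<^sub>-\<^sub>1 a\<^sub>j\<^sub>+\<^sub>1 \<le> a\<^sub>i a\<^sub>j \<le> a\<^sub>i\<^sub>+\<^sub>1 a\<^sub>j\<^sub>-\<^sub>1\<close>. The weight just past the degree also has to be nonnegative:
  it occurs in the middle terms when \<open>j\<close> is the degree.
\<close>

lemma log_concave_affine_step:
  fixes u v e :: real
  assumes "log_concave p" "0 \<le> e" "0 \<le> v" and u: "v * (real (degree p) + 1) \<le> u"
  shows "log_concave ([:u, e:] * p - smult v (pCons 0 (pderiv p)))" (is "log_concave ?q")
proof -
  define a where "a = coeff p"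
  define s where "s = coeff (pCons 0 p)"
  define d where "d k = u - v * real k" for k
  have s_Suc: "s (Suc k) = a k" for k by (simp add: s_def a_def)
  have q: "coeff ?q k = d k * a k + e * s k" for k
    unfolding coeff_affine_step a_def s_def d_def ..
  have a0: "0 \<le> a k" for k using log_concave_nonneg[OF assms(1)] by (simp add: a_def)
  have s0: "0 \<le> s k" for k using a0 by (cases k) (simp_all add: s_def a_def)
  have d0: "0 \<le> d k" if "k \<le> Suc (degree p)" for k
  proof -
    have "v * real k \<le> v * (real (degree p) + 1)"
      using that assms(3) by (intro mult_left_mono) auto
    then show ?thesis using u by (simp add: d_def)
  qed
  have da0: "0 \<le> d k * a k" for k
    using a0 d0 by (cases "k \<le> degree p") (auto simp: a_def coeff_eq_0)
  have q0: "0 \<le> coeff ?q k" for k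
    unfolding q using da0 s0 assms(2) by simp
  have "coeff ?q i * coeff ?q (Suc j) \<le> coeff ?q (Suc i) * coeff ?q j" if "i \<le> j" for i j
  proof (cases "i = j \<or> degree p < j")
    case True
    then show ?thesis
    proof
      assume "degree p < j"
      then have "coeff ?q (Suc j) = 0" unfolding q s_Suc by (simp add: a_def coeff_eq_0)
      then show ?thesis using q0 by (simp only: mult_zero_right mult_nonneg_nonneg)
    qed (simp only: mult.commute order_refl)
  next
    case False
    then have "i < j" and j: "j \<le> degree p" using that by auto
    then obtain l where l: "j = Suc l" "i \<le> l" by (cases j) auto
    have dpos: "0 \<le> d i" "0 \<le> d (Suc i)" "0 \<le> d j" "0 \<le> d (Suc j)"
      using d0 \<open>i < j\<close> j by auto
    have aa: "a i * a (Suc j) \<le> a (Suc i) * a j"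
      using log_concaveD[OF assms(1) that] by (simp add: a_def)
    have upper: "a i * a j \<le> a (Suc i) * s j"
      using log_concaveD[OF assms(1) l(2)] by (simp add: a_def l s_def)
    have lower: "s i * a (Suc j) \<le> a i * a j"
      using log_concaveD[OF assms(1), of "i - 1" j] a0 \<open>i < j\<close>
      by (cases i) (auto simp: a_def s_def)
    have ss: "s i * a j \<le> a i * s j"
      using log_concaveD[OF assms(1), of "i - 1" l] a0 l
      by (cases i) (auto simp: a_def s_def)
    have dd: "d i * d (Suc j) \<le> d (Suc i) * d j"
    proof -
      have "d (Suc i) * d j - d i * d (Suc j) = v * v * (real j - real i)"
        by (simp add: d_def algebra_simps)
      moreover have "0 \<le> v * v * (real j - real i)" using \<open>i < j\<close> by simp
      ultimately show ?thesis by linarith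
    qed
    have T1: "(d i * d (Suc j)) * (a i * a (Suc j)) \<le> (d (Suc i) * d j) * (a (Suc i) * a j)"
      by (rule mult_mono[OF dd aa]) (use dpos a0 in auto)
    have "(d i - d j) * (a i * a j) + d (Suc j) * (s i * a (Suc j))
        \<le> (d i - d j) * (a i * a j) + d (Suc j) * (a i * a j)"
      using lower dpos by (intro add_left_mono mult_left_mono)
    also have "\<dots> = d (Suc i) * (a i * a j)"
      by (simp add: d_def algebra_simps)
    also have "\<dots> \<le> d (Suc i) * (a (Suc i) * s j)"
      using upper dpos by (intro mult_left_mono)
    finally have T2: "e * (d i * (a i * a j) + d (Suc j) * (s i * a (Suc j)))
        \<le> e * (d j * (a i * a j) + d (Suc i) * (a (Suc i) * s j))"
      using assms(2) by (intro mult_left_mono) (auto simp: algebra_simps)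
    have T3: "(e * e) * (s i * a j) \<le> (e * e) * (a i * s j)"
      using ss by (intro mult_left_mono) auto
    show ?thesis
      unfolding q s_Suc using T1 T2 T3 by (simp add: algebra_simps)
  qed
  with q0 show ?thesis unfolding log_concave_def by blast
qed

section \<open>The substitution of x + 1 for x\<close>

lemma poly_mono_coeff:
  fixes p q :: "real poly"
  assumes "\<And>k. coeff p k \<le> coeff q k" "0 \<le> x"
  shows "poly p x \<le> poly q x"
proof -
  have "poly r x = (\<Sum>k\<le>max (degree p) (degree q). coeff r k * x ^ k)"
    if "r = p \<or> r = q" for r
    unfolding poly_altdef using that
    by (intro sum.mono_neutral_left) (auto simp: coeff_eq_0)
  then show ?thesis
    using assms by (auto intro!: sum_mono mult_right_mono)
qed

lemma poly_1_pos:
  fixes p :: "real poly"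
  assumes "\<And>k. 0 \<le> coeff p k" "p \<noteq> 0"
  shows "0 < poly p 1"
proof -
  have "lead_coeff p \<le> (\<Sum>k\<le>degree p. coeff p k)"
    using assms(1) by (intro member_le_sum) auto
  moreover have "0 < lead_coeff p"
    using assms(1)[of "degree p"] assms(2) by (simp add: order_less_le)
  ultimately show ?thesis by (simp add: poly_altdef)
qed

text \<open>
  The coefficient of \<open>x\<^sup>j\<close> on the left is \<open>j + 1\<close> copies of \<open>a g\<^sub>j\<^sub>+\<^sub>1\<close>, and on the right it is a sum of
  \<open>j + 1\<close> products \<open>g\<^sub>i g\<^sub>j\<^sub>-\<^sub>i\<close>. As coefficients of \<open>a + x g\<close>, the two factors have the same sum of
  indices in all these products, and \<open>a g\<^sub>j\<^sub>+\<^sub>1\<close> is the one with the indices furthest apart.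
\<close>

lemma log_concave_pderiv_le_square:
  assumes "log_concave (pCons a g)"
  shows "coeff (smult a (pderiv g)) j \<le> coeff (g * g) j"
proof -
  have "coeff (smult a (pderiv g)) j = (\<Sum>i\<le>j. a * coeff g (Suc j))"
    by (simp add: coeff_pderiv algebra_simps)
  also have "\<dots> \<le> (\<Sum>i\<le>j. coeff g i * coeff g (j - i))"
  proof (intro sum_mono)
    fix i assume "i \<in> {..j}"
    then show "a * coeff g (Suc j) \<le> coeff g i * coeff g (j - i)"
      using log_concave_endpoints[OF assms, of "Suc i" "Suc (j - i)"] by simp
  qed
  finally show ?thesis by (simp add: coeff_mult)
qed

text \<open>
  This is \<open>f(1) f''(1) / 2 \<le> f'(1)\<^sup>2\<close> for \<open>f = a + x g\<close>, with the values of \<open>f\<close> written in terms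
  of those of \<open>g\<close>. After expansion, \<open>g'(1)\<^sup>2\<close> absorbs \<open>g(1) g''(1) / 2\<close>, which is the same inequality for
  \<open>g\<close>; the terms with \<open>a\<close> are absorbed by the coefficientwise bound \<open>a g' \<le> g\<^sup>2\<close> and by its derivative
  \<open>a g'' \<le> 2 g g'\<close>.
\<close>

lemma log_concave_taylor_at_1:
  assumes "log_concave (pCons a g)"
    and IH: "poly g 1 * (poly (pderiv (pderiv g)) 1 / 2) \<le> (poly (pderiv g) 1)\<^sup>2"
  shows "(a + poly g 1) * (poly (pderiv g) 1 + poly (pderiv (pderiv g)) 1 / 2)
    \<le> (poly g 1 + poly (pderiv g) 1)\<^sup>2"
proof -
  note le = log_concave_pderiv_le_square[OF assms(1)]
  have first: "a * poly (pderiv g) 1 \<le> (poly g 1)\<^sup>2"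
    using poly_mono_coeff[OF le, of 1] by (simp add: power2_eq_square)
  have "coeff (pderiv (smult a (pderiv g))) k \<le> coeff (pderiv (g * g)) k" for k
    unfolding coeff_pderiv using le by (intro mult_left_mono) auto
  from poly_mono_coeff[OF this, of 1]
  have second: "a * poly (pderiv (pderiv g)) 1 \<le> 2 * (poly g 1 * poly (pderiv g) 1)"
    by (simp add: pderiv_smult pderiv_mult)
  show ?thesis
    using first second IH unfolding power2_eq_square distrib_left distrib_right
    by (simp add: field_simps)
qed

lemma coeff_shift_low:
  fixes g :: "real poly"
  shows "coeff (pcompose g [:1, 1:]) 0 = poly g 1"
    and "coeff (pcompose g [:1, 1:]) 1 = poly (pderiv g) 1"
    and "coeff (pcompose g [:1, 1:]) 2 = poly (pderiv (pderiv g)) 1 / 2"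
proof -
  have zero: "coeff (pcompose h [:1, 1:]) 0 = poly h 1" for h :: "real poly"
    using poly_pcompose[of h "[:1, 1:]" 0] by (simp add: poly_0_coeff_0)
  have deriv: "pderiv (pcompose h [:1, 1:]) = pcompose (pderiv h) [:1, 1:]" for h :: "real poly"
    by (simp add: pderiv_pcompose pderiv_pCons)
  have one: "coeff (pcompose h [:1, 1:]) 1 = poly (pderiv h) 1" for h :: "real poly"
    using arg_cong[OF deriv[of h], of "\<lambda>p. coeff p 0"] by (simp add: coeff_pderiv zero)
  have "2 * coeff (pcompose g [:1, 1:]) 2 = coeff (pcompose (pderiv g) [:1, 1:]) 1"
    using arg_cong[OF deriv[of g], of "\<lambda>p. coeff p 1"]
    by (simp add: coeff_pderiv numeral_2_eq_2)
  then show "coeff (pcompose g [:1, 1:]) 2 = poly (pderiv (pderiv g)) 1 / 2"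
    unfolding one by simp
  show "coeff (pcompose g [:1, 1:]) 0 = poly g 1"
    and "coeff (pcompose g [:1, 1:]) 1 = poly (pderiv g) 1"
    by (fact zero one)+
qed

text \<open>
  Only the inequalities with \<open>i = 0\<close> notice a change of the constant coefficient. The case \<open>j = 0\<close> is
  an equality, and the case \<open>j = 1\<close> implies the later ones: multiply it by \<open>c\<^sub>1 c\<^sub>j\<^sub>+\<^sub>1 \<le> c\<^sub>2 c\<^sub>j\<close> and cancel.
\<close>

lemma log_concave_add_const:
  assumes "log_concave h" "0 \<le> a" "0 < coeff h 1"
    and first: "(a + coeff h 0) * coeff h 2 \<le> (coeff h 1)\<^sup>2"
  shows "log_concave ([:a:] + h)"
proof -
  have c0: "0 \<le> coeff h k" for k by (rule log_concave_nonneg[OF assms(1)])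
  have Suc: "coeff ([:a:] + h) (Suc k) = coeff h (Suc k)" for k by simp
  have zero: "coeff ([:a:] + h) 0 = a + coeff h 0" by simp
  have bound: "(a + coeff h 0) * coeff h (Suc j) \<le> coeff h 1 * coeff h j" if "0 < j" for j
  proof (cases "coeff h 2 = 0")
    case True
    have "coeff h 1 * coeff h (Suc j) \<le> 0"
      using log_concaveD[OF assms(1), of 1 j] that True by (simp add: numeral_2_eq_2)
    then have "coeff h (Suc j) = 0"
      using assms(3) c0[of "Suc j"] by (simp add: mult_le_0_iff)
    then show ?thesis using c0 by simp
  next
    case False
    then have pos: "0 < coeff h 1 * coeff h 2"
      using c0[of 2] assms(3) by simp
    have "((a + coeff h 0) * coeff h 2) * (coeff h 1 * coeff h (Suc j))
        \<le> (coeff h 1)\<^sup>2 * (coeff h 2 * coeff h j)"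
    proof (rule mult_mono[OF first])
      show "coeff h 1 * coeff h (Suc j) \<le> coeff h 2 * coeff h j"
        using log_concaveD[OF assms(1), of 1 j] that by (simp add: numeral_2_eq_2)
    qed (use c0 in auto)
    then have "(coeff h 1 * coeff h 2) * ((a + coeff h 0) * coeff h (Suc j))
        \<le> (coeff h 1 * coeff h 2) * (coeff h 1 * coeff h j)"
      by (simp add: power2_eq_square ac_simps)
    then show ?thesis using pos by (simp only: mult_le_cancel_left_pos)
  qed
  show ?thesis
    unfolding log_concave_def
  proof (intro conjI allI impI)
    show "0 \<le> coeff ([:a:] + h) i" for i
      using c0 assms(2) by (cases i) (simp_all add: zero Suc)
    fix i j :: nat
    assume "i \<le> j"
    show "coeff ([:a:] + h) i * coeff ([:a:] + h) (Suc j)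
        \<le> coeff ([:a:] + h) (Suc i) * coeff ([:a:] + h) j"
    proof (cases "i = 0")
      case True
      then show ?thesis
        using bound[of j] by (cases j) (simp_all only: Suc zero One_nat_def mult.commute zero_less_Suc order_refl)
    next
      case False
      then obtain i' j' where "i = Suc i'" "j = Suc j'"
        using \<open>i \<le> j\<close> by (cases i; cases j) auto
      then show ?thesis
        unfolding Suc using log_concaveD[OF assms(1) \<open>i \<le> j\<close>] by (simp only: Suc)
    qed
  qed
qed

text \<open>Horner's scheme \<open>f(1 + x) = a + (1 + x) g(1 + x)\<close> drives the induction.\<close>

lemma log_concave_shift:
  "log_concave f \<Longrightarrow> log_concave (pcompose f [:1, 1:])"
proof (induction f)
  case 0
  then show ?case by simp
next
  case (pCons a g)
  have g: "log_concave g" using pCons.prems by (rule log_concave_pCons_tail)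
  have a: "0 \<le> a" using log_concave_nonneg[OF pCons.prems, of 0] by simp
  define G where "G = pcompose g [:1, 1:]"
  have G: "log_concave G" unfolding G_def by (rule pCons.IH[OF g])
  have h: "log_concave ([:1, 1:] * G)"
    using log_concave_affine_step[OF G, of 1 0 1] by simp
  have f: "pcompose (pCons a g) [:1, 1:] = [:a:] + [:1, 1:] * G"
    by (simp add: pcompose_pCons G_def)
  have h_coeffs:
    "coeff ([:1, 1:] * G) 0 = poly g 1"
    "coeff ([:1, 1:] * G) 1 = poly g 1 + poly (pderiv g) 1"
    "coeff ([:1, 1:] * G) 2 = poly (pderiv g) 1 + poly (pderiv (pderiv g)) 1 / 2"
    using coeff_shift_low[of g] by (simp_all add: G_def numeral_2_eq_2)
  show ?case
  proof (cases "g = 0")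
    case True
    then show ?thesis using pCons.prems by simp
  next
    case False
    have "0 < poly g 1"
      using poly_1_pos[OF log_concave_nonneg[OF g] False] .
    moreover have "0 \<le> poly (pderiv g) 1"
      using log_concave_nonneg[OF G, of 1] coeff_shift_low(2)[of g] by (simp add: G_def)
    ultimately have pos: "0 < coeff ([:1, 1:] * G) 1"
      unfolding h_coeffs by linarith
    have "poly g 1 * (poly (pderiv (pderiv g)) 1 / 2) \<le> (poly (pderiv g) 1)\<^sup>2"
      using log_concaveD[OF G, of 0 1]
      unfolding G_def coeff_shift_low(1) Suc_1 One_nat_def[symmetric] coeff_shift_low(2,3)
      by (simp add: power2_eq_square)
    from log_concave_taylor_at_1[OF pCons.prems this]
    show ?thesis
      unfolding f using log_concave_add_const[OF h a pos] unfolding h_coeffs by blast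
  qed
qed

section \<open>The polynomials in the variable x = w + 1\<close>

text \<open>The index is shifted: \<open>r_poly m\<close> is \<open>r\<^sub>m\<^sub>+\<^sub>1\<close>.\<close>

primrec r_poly :: "nat \<Rightarrow> real poly" where
  "r_poly 0 = 1"
| "r_poly (Suc m) =
     [:2 * real (Suc m) - 1, real (Suc m):] * r_poly m - pCons 0 (pderiv (r_poly m))"

lemma p_poly_eq_r_poly_shift:
  "p_poly (Suc m) = smult ((-1) ^ m) (pcompose (r_poly m) [:1, 1:])"
proof (induction m)
  case (Suc m)
  let ?R = "pcompose (r_poly m) [:1, 1:]"
  have deriv: "pcompose (pderiv (r_poly m)) [:1, 1:] = pderiv ?R"
    by (simp add: pderiv_pcompose pderiv_pCons)
  have shift: "pcompose (pCons 0 q) [:1, 1:] = [:1, 1:] * pcompose q [:1, 1:]" for q :: "real poly"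
    by (simp add: pcompose_pCons)
  have affine: "pcompose [:2 * real (Suc m) - 1, real (Suc m):] [:1, 1:]
      = [:3 * real (Suc m) - 1, real (Suc m):]"
    by (simp add: pcompose_pCons)
  have "pcompose (r_poly (Suc m)) [:1, 1:]
      = [:3 * real (Suc m) - 1, real (Suc m):] * ?R - [:1, 1:] * pderiv ?R"
    by (simp only: r_poly.simps pcompose_diff pcompose_mult shift affine deriv)
  then show ?case
    by (simp only: p_poly.simps Suc.IH pderiv_smult power_Suc mult_smult_right smult_diff_right
        mult_minus1 smult_minus_left minus_diff_eq)
qed (simp add: pcompose_1)

lemma degree_r_poly: "degree (r_poly m) \<le> m"
proof (induction m)
  case (Suc m)
  have "degree ([:2 * real (Suc m) - 1, real (Suc m):] * r_poly m) \<le> Suc m"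
    using degree_mult_le[of "[:2 * real (Suc m) - 1, real (Suc m):]" "r_poly m"] Suc by simp
  moreover have "degree (pCons 0 (pderiv (r_poly m))) \<le> Suc m"
    using Suc by (intro order_trans[OF degree_pCons_le]) (simp add: degree_pderiv)
  ultimately show ?case by (simp only: r_poly.simps degree_diff_le)
qed simp

lemma log_concave_r_poly: "log_concave (r_poly m)"
proof (induction m)
  case 0
  show ?case by (auto simp: log_concave_def coeff_1)
next
  case (Suc m)
  have "log_concave ([:2 * real (Suc m) - 1, real (Suc m):] * r_poly m
      - smult 1 (pCons 0 (pderiv (r_poly m))))"
    using Suc degree_r_poly[of m] by (intro log_concave_affine_step) auto
  then show ?case by (simp only: r_poly.simps smult_1_left)
qed

theorem corollary3p5:
  fixes n :: nat
  assumes "n \<ge> 3"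
  shows "unimodal (n - 1) (\<lambda>k. beta n k)"
proof -
  obtain m where n: "n = Suc m" using assms by (cases n) auto
  have "beta n k = coeff (pcompose (r_poly m) [:1, 1:]) k" for k
    by (simp add: beta_def n p_poly_eq_r_poly_shift flip: mult.assoc power_mult_distrib)
  then show ?thesis
    using log_concave_imp_unimodal[OF log_concave_shift[OF log_concave_r_poly]] by simp
qed

end
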